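(* Let $X$ and $Y$ be L-algebras such that $Y$ operates on $X$ via $\rho$. Let $P$ be an ideal of $X$ and $Q$ an ideal of $Y$. Then $P\rtimes Q$ is a prime ideal of $X\rtimes_\rho Y$ if and only if one of the following holds: (1) $P=X$ and $Q$ is a prime ideal of $Y$; (2) $P$ is a $\rho$-prime ideal of $X$ and $Q=\ker(\rho^P)$. Moreover, there is a bijection $$\mathrm{Spec}(X\rtimes_\rho Y)\;\cong\;\rho\mathrm{Spec}(X)\sqcup\mathrm{Spec}(Y),$$ given by $X\rtimes Q\mapsto Q$ and $P\rtimes Q\mapsto P$ for $P\ne X$.
   Context: An L-algebra is a set $X$ with a binary operation $\cdot$ and a distinguished element $1$ such that for all $x,y,z\in X$: $1\cdot x=x$ and $x\cdot 1=x\cdot x=1$; $(x\cdot y)\cdot(x\cdot z)=(y\cdot x)\cdot(y\cdot z)$; and $x\cdot y=y\cdot x=1$ implies $x=y$. $\mathrm{End}(X)$ is the set of maps $f:X\to X$ with $f(x\cdot y)=f(x)\cdot f(y)$. An ideal of $X$ is a nonempty subset $I\subseteq X$ such that for all $x\in I$, $y\in X$: (I1) $x\cdot y\in I$ implies $y\in I$; (I2) $y\cdot x\in I$; (I3) $(x\cdot y)\cdot y\in I$; (I4) $y\cdot(x\cdot y)\in I$. $\langle x\rangle$ is the ideal generated by $x$. For ideals $I,J$ put $I\cdot J=\{x\in X\mid\langle x\rangle\cap I\subseteq J\}$, which is an ideal. A proper ideal $P$ is prime if for every ideal $I$ either $I\subseteq P$ or $I\cdot P\subseteq P$. $\mathrm{Spec}(X)$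 is the set of prime ideals of $X$. An L-algebra $Y$ operates on an L-algebra $X$ via $\rho:Y\to\mathrm{End}(X)$, $u\mapsto\rho_u$, if $\rho_1=\mathrm{id}$ and $\rho_{u\cdot v}\circ\rho_u=\rho_{v\cdot u}\circ\rho_v$ for all $u,v\in Y$. The semidirect product $X\rtimes_\rho Y$ is the L-algebra on $X\times Y$ with operation $(x,u)\cdot(y,v)=(\rho_{u\cdot v}(x)\cdot\rho_{v\cdot u}(y),\,u\cdot v)$. Every ideal of $X\rtimes_\rho Y$ has the form $I\times U$ with $I$ an ideal of $X$ and $U$ an ideal of $Y$; $I\rtimes U$ denotes the subset $I\times U$. A $\rho$-ideal of $X$ is an ideal $I$ with $\rho_v(I)\subseteq I$ for every $v\in Y$. A proper $\rho$-ideal $P$ is $\rho$-prime if for all $\rho$-ideals $I_1,I_2$ of $X$ with $I_1\cap I_2\subseteq P$, either $I_1\subseteq P$ or $I_2\subseteq P$. $\rho\mathrm{Spec}(X)$ is the set of $\rho$-prime ideals of $X$. For a $\rho$-ideal $P$, $\rho^P:Y\to\mathrm{End}(X/P)$ is the induced operation $\rho^P_u([x])=[\rho_u(x)]$, where $X/P$ is the quotient by the congruence $x\equiv y\iff x\cdot y,\ y\cdot x\in P$. $\ker(\rho^P)$ denotes the largest ideal $V$ of $Y$ such that $P\rtimes V$ is an ideal of $X\rtimes_\rho Y$ (equivalently, the largest ideal $V$ of $Y$ such that $\rho^P_u=\mathrm{id}$ for all $u\in V$). *)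

theory Defs
  imports "HOL-Algebra.Congruence"
begin

record 'a l_alg = "'a partial_object" +
  l_op :: "'a \<Rightarrow> 'a \<Rightarrow> 'a" (infixl "\<cdot>\<index>" 70)
  l_one :: 'a ("\<one>\<index>")

locale l_algebra =
  fixes X :: "'a l_alg" (structure)
  assumes one_closed: "\<one> \<in> carrier X"
    and op_closed: "\<lbrakk>x \<in> carrier X; y \<in> carrier X\<rbrakk> \<Longrightarrow> x \<cdot> y \<in> carrier X"
    and one_op: "x \<in> carrier X \<Longrightarrow> \<one> \<cdot> x = x"
    and op_one: "x \<in> carrier X \<Longrightarrow> x \<cdot> \<one> = \<one>"
    and op_self: "x \<in> carrier X \<Longrightarrow> x \<cdot> x = \<one>"
    and cycloid: "\<lbrakk>x \<in> carrier X; y \<in> carrier X; z \<in> carrier X\<rbrakk>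
      \<Longrightarrow> (x \<cdot> y) \<cdot> (x \<cdot> z) = (y \<cdot> x) \<cdot> (y \<cdot> z)"
    and antisym: "\<lbrakk>x \<in> carrier X; y \<in> carrier X; x \<cdot> y = \<one>; y \<cdot> x = \<one>\<rbrakk> \<Longrightarrow> x = y"

text \<open>
  Endomorphisms are only constrained on the carrier; accordingly equality of endomorphisms
  is tested pointwise on the carrier in \<open>l_operation\<close> below.
\<close>
definition l_End :: "'a l_alg \<Rightarrow> ('a \<Rightarrow> 'a) set" where
  "l_End X = {f \<in> carrier X \<rightarrow> carrier X.
     \<forall>x\<in>carrier X. \<forall>y\<in>carrier X. f (x \<cdot>\<^bsub>X\<^esub> y) = f x \<cdot>\<^bsub>X\<^esub> f y}"

definition l_ideal :: "'a l_alg \<Rightarrow> 'a set \<Rightarrow> bool" where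
  "l_ideal X I \<longleftrightarrow> I \<subseteq> carrier X \<and> I \<noteq> {} \<and>
     (\<forall>x\<in>I. \<forall>y\<in>carrier X.
        (x \<cdot>\<^bsub>X\<^esub> y \<in> I \<longrightarrow> y \<in> I) \<and>
        y \<cdot>\<^bsub>X\<^esub> x \<in> I \<and>
        (x \<cdot>\<^bsub>X\<^esub> y) \<cdot>\<^bsub>X\<^esub> y \<in> I \<and>
        y \<cdot>\<^bsub>X\<^esub> (x \<cdot>\<^bsub>X\<^esub> y) \<in> I)"

definition gen_ideal :: "'a l_alg \<Rightarrow> 'a \<Rightarrow> 'a set" where
  "gen_ideal X x = \<Inter>{I. l_ideal X I \<and> x \<in> I}"

definition ideal_op :: "'a l_alg \<Rightarrow> 'a set \<Rightarrow> 'a set \<Rightarrow> 'a set" where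
  "ideal_op X I J = {x \<in> carrier X. gen_ideal X x \<inter> I \<subseteq> J}"

definition prime_ideal :: "'a l_alg \<Rightarrow> 'a set \<Rightarrow> bool" where
  "prime_ideal X P \<longleftrightarrow> l_ideal X P \<and> P \<noteq> carrier X \<and>
     (\<forall>I. l_ideal X I \<longrightarrow> I \<subseteq> P \<or> ideal_op X I P \<subseteq> P)"

definition Spec :: "'a l_alg \<Rightarrow> 'a set set" where
  "Spec X = {P. prime_ideal X P}"

definition l_operation :: "'a l_alg \<Rightarrow> 'b l_alg \<Rightarrow> ('b \<Rightarrow> 'a \<Rightarrow> 'a) \<Rightarrow> bool" where
  "l_operation X Y \<rho> \<longleftrightarrow>
     \<rho> \<in> carrier Y \<rightarrow> l_End X \<and>
     (\<forall>x\<in>carrier X. \<rho> \<one>\<^bsub>Y\<^esub> x = x) \<and>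
     (\<forall>u\<in>carrier Y. \<forall>v\<in>carrier Y. \<forall>x\<in>carrier X.
        \<rho> (u \<cdot>\<^bsub>Y\<^esub> v) (\<rho> u x) = \<rho> (v \<cdot>\<^bsub>Y\<^esub> u) (\<rho> v x))"

definition semidirect :: "'a l_alg \<Rightarrow> 'b l_alg \<Rightarrow> ('b \<Rightarrow> 'a \<Rightarrow> 'a) \<Rightarrow> ('a \<times> 'b) l_alg" where
  "semidirect X Y \<rho> =
     \<lparr>carrier = carrier X \<times> carrier Y,
      l_op = (\<lambda>(x, u) (y, v).
        (\<rho> (u \<cdot>\<^bsub>Y\<^esub> v) x \<cdot>\<^bsub>X\<^esub> \<rho> (v \<cdot>\<^bsub>Y\<^esub> u) y, u \<cdot>\<^bsub>Y\<^esub> v)),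
      l_one = (\<one>\<^bsub>X\<^esub>, \<one>\<^bsub>Y\<^esub>)\<rparr>"

definition rho_ideal :: "'a l_alg \<Rightarrow> 'b l_alg \<Rightarrow> ('b \<Rightarrow> 'a \<Rightarrow> 'a) \<Rightarrow> 'a set \<Rightarrow> bool" where
  "rho_ideal X Y \<rho> I \<longleftrightarrow> l_ideal X I \<and> (\<forall>v\<in>carrier Y. \<rho> v ` I \<subseteq> I)"

definition rho_prime :: "'a l_alg \<Rightarrow> 'b l_alg \<Rightarrow> ('b \<Rightarrow> 'a \<Rightarrow> 'a) \<Rightarrow> 'a set \<Rightarrow> bool" where
  "rho_prime X Y \<rho> P \<longleftrightarrow> rho_ideal X Y \<rho> P \<and> P \<noteq> carrier X \<and>
     (\<forall>I\<^sub>1 I\<^sub>2. rho_ideal X Y \<rho> I\<^sub>1 \<and> rho_ideal X Y \<rho> I\<^sub>2 \<and> I\<^sub>1 \<inter> I\<^sub>2 \<subseteq> P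
        \<longrightarrow> I\<^sub>1 \<subseteq> P \<or> I\<^sub>2 \<subseteq> P)"

definition rho_Spec :: "'a l_alg \<Rightarrow> 'b l_alg \<Rightarrow> ('b \<Rightarrow> 'a \<Rightarrow> 'a) \<Rightarrow> 'a set set" where
  "rho_Spec X Y \<rho> = {P. rho_prime X Y \<rho> P}"

text \<open>
  The kernel of the operation \<open>\<rho>\<^sup>P\<close> induced on \<open>X/P\<close>, as the largest (with respect to inclusion)
  ideal \<open>V\<close> of \<open>Y\<close> for which \<open>P \<times> V\<close> is an ideal of the semidirect product. The value is
  unspecified unless such a largest ideal exists; it is meant for \<open>\<rho>\<close>-ideals \<open>P\<close> only.
\<close>
definition ker_quot :: "'a l_alg \<Rightarrow> 'b l_alg \<Rightarrow> ('b \<Rightarrow> 'a \<Rightarrow> 'a) \<Rightarrow> 'a set \<Rightarrow> 'b set" where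
  "ker_quot X Y \<rho> P = (GREATEST V. l_ideal Y V \<and> l_ideal (semidirect X Y \<rho>) (P \<times> V))"

end

theory Submission imports Defs begin

text \<open>
  The ideals of \<open>X \<rtimes> Y\<close> are the sets \<open>I \<times> U\<close> with \<open>I\<close> a \<open>\<rho>\<close>-ideal and \<open>U\<close> an ideal whose elements act
  trivially on \<open>X/I\<close>. Primality of an ideal means primality with respect to intersection, so it can
  be tested against the ideals \<open>I \<times> {1}\<close> and \<open>X \<times> U\<close>; testing \<open>P \<times> Q\<close> against the pair \<open>X \<times> {1}\<close>,
  \<open>P \<times> ker \<rho>\<^sup>P\<close> forces \<open>Q = ker \<rho>\<^sup>P\<close> when \<open>P \<noteq> X\<close>. The largest ideal acting trivially on \<open>X/P\<close>
  exists because the ideal congruences of an L-algebra permute at \<open>1\<close>, which makes the join of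
  two ideals explicit.
\<close>

subsection \<open>Ideals and their congruences\<close>

text \<open>The relation defining \<open>X/I\<close>, kept as a bare predicate: statements about
  \<open>X/I\<close> are made with representatives and the quotient is never formed. It is a
  congruence once \<open>I\<close> is an ideal.\<close>

definition ideal_cong :: "'a l_alg \<Rightarrow> 'a set \<Rightarrow> 'a \<Rightarrow> 'a \<Rightarrow> bool" where
  "ideal_cong X I x y \<longleftrightarrow> x \<cdot>\<^bsub>X\<^esub> y \<in> I \<and> y \<cdot>\<^bsub>X\<^esub> x \<in> I"

text \<open>The union of the \<open>I\<close>-classes that meet \<open>J\<close>, that is, the
  preimage in \<open>X\<close> of the image of \<open>J\<close> in \<open>X/I\<close>. The two
  arguments enter differently, but for ideals the result turns out to be symmetric.\<close>

definition ideal_join :: "'a l_alg \<Rightarrow> 'a set \<Rightarrow> 'a set \<Rightarrow> 'a set" where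
  "ideal_join X I J = {x \<in> carrier X. \<exists>a\<in>J. ideal_cong X I x a}"

lemma ideal_cong_sym: "ideal_cong X I x y \<Longrightarrow> ideal_cong X I y x"
  by (simp add: ideal_cong_def)

lemma ideal_cong_mono: "ideal_cong X I x y \<Longrightarrow> I \<subseteq> J \<Longrightarrow> ideal_cong X J x y"
  by (auto simp: ideal_cong_def)

lemma ideal_carrier: "l_ideal X I \<Longrightarrow> x \<in> I \<Longrightarrow> x \<in> carrier X"
  unfolding l_ideal_def by blast

lemma ideal_I1: "l_ideal X I \<Longrightarrow> x \<in> I \<Longrightarrow> y \<in> carrier X \<Longrightarrow> x \<cdot>\<^bsub>X\<^esub> y \<in> I \<Longrightarrow> y \<in> I"
  unfolding l_ideal_def by blast

lemma ideal_I2: "l_ideal X I \<Longrightarrow> x \<in> I \<Longrightarrow> y \<in> carrier X \<Longrightarrow> y \<cdot>\<^bsub>X\<^esub> x \<in> I"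
  unfolding l_ideal_def by blast

lemma ideal_I3: "l_ideal X I \<Longrightarrow> x \<in> I \<Longrightarrow> y \<in> carrier X \<Longrightarrow> (x \<cdot>\<^bsub>X\<^esub> y) \<cdot>\<^bsub>X\<^esub> y \<in> I"
  unfolding l_ideal_def by blast

lemma ideal_I4: "l_ideal X I \<Longrightarrow> x \<in> I \<Longrightarrow> y \<in> carrier X \<Longrightarrow> y \<cdot>\<^bsub>X\<^esub> (x \<cdot>\<^bsub>X\<^esub> y) \<in> I"
  unfolding l_ideal_def by blast

context l_algebra
begin

lemma ideal_one: assumes "l_ideal X I" shows "\<one> \<in> I"
proof -
  obtain x where x: "x \<in> I" using assms by (auto simp: l_ideal_def)
  note xX = ideal_carrier[OF assms x]
  show ?thesis using ideal_I2[OF assms x xX] op_self[OF xX] by simp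
qed

lemma ideal_carrier_set: "l_ideal X (carrier X)"
  using one_closed op_closed by (auto simp: l_ideal_def)

lemma ideal_trivial: "l_ideal X {\<one>}"
  using one_closed by (auto simp: l_ideal_def one_op op_one op_self op_closed)

section \<open>Generated ideals and primality by intersections\<close>

lemma ideal_Inter:
  assumes "\<And>I. I \<in> \<I> \<Longrightarrow> l_ideal X I" and "\<I> \<noteq> {}"
  shows "l_ideal X (\<Inter>\<I>)"
  unfolding l_ideal_def
proof (intro conjI ballI)
  show "\<Inter>\<I> \<subseteq> carrier X"
  proof
    fix x assume "x \<in> \<Inter>\<I>"
    moreover obtain I where "I \<in> \<I>" using assms(2) by auto
    ultimately show "x \<in> carrier X" using ideal_carrier[OF assms(1)] by auto
  qed
  have "\<one> \<in> \<Inter>\<I>" using ideal_one[OF assms(1)] by simp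
  then show "\<Inter>\<I> \<noteq> {}" by (metis empty_iff)
  fix x y assume xy: "x \<in> \<Inter>\<I>" "y \<in> carrier X"
  have I: "l_ideal X I" "x \<in> I" if "I \<in> \<I>" for I using xy assms that by auto
  show "x \<cdot> y \<in> \<Inter>\<I> \<longrightarrow> y \<in> \<Inter>\<I>" using ideal_I1[OF I xy(2)] by auto
  show "y \<cdot> x \<in> \<Inter>\<I>" using ideal_I2[OF I xy(2)] by auto
  show "(x \<cdot> y) \<cdot> y \<in> \<Inter>\<I>" using ideal_I3[OF I xy(2)] by auto
  show "y \<cdot> (x \<cdot> y) \<in> \<Inter>\<I>" using ideal_I4[OF I xy(2)] by auto
qed

lemma gen_ideal_ideal: "x \<in> carrier X \<Longrightarrow> l_ideal X (gen_ideal X x)"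
  unfolding gen_ideal_def using ideal_carrier_set by (intro ideal_Inter) fast+

lemma gen_ideal_mem: "x \<in> gen_ideal X x"
  by (auto simp: gen_ideal_def)

lemma gen_ideal_least: "l_ideal X I \<Longrightarrow> x \<in> I \<Longrightarrow> gen_ideal X x \<subseteq> I"
  by (auto simp: gen_ideal_def)

text \<open>For an ideal \<open>I\<close>, the set \<open>ideal_op X I P\<close> contains every
  ideal \<open>J\<close> with \<open>I \<inter> J \<subseteq> P\<close>, and each of its elements
  lies in such a \<open>J\<close>, namely the ideal that it generates. So a test against
  \<open>ideal_op X I P\<close> amounts to a test against all such \<open>J\<close>.\<close>

lemma prime_ideal_iff_inter:
  "prime_ideal X P \<longleftrightarrow> l_ideal X P \<and> P \<noteq> carrier X \<and>
     (\<forall>I J. l_ideal X I \<longrightarrow> l_ideal X J \<longrightarrow> I \<inter> J \<subseteq> P \<longrightarrow> I \<subseteq> P \<or> J \<subseteq> P)"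
proof -
  have "(\<forall>I. l_ideal X I \<longrightarrow> I \<subseteq> P \<or> ideal_op X I P \<subseteq> P) \<longleftrightarrow>
     (\<forall>I J. l_ideal X I \<longrightarrow> l_ideal X J \<longrightarrow> I \<inter> J \<subseteq> P \<longrightarrow> I \<subseteq> P \<or> J \<subseteq> P)" (is "?L \<longleftrightarrow> ?R")
  proof
    assume L: ?L
    have "J \<subseteq> ideal_op X I P" if "l_ideal X J" "I \<inter> J \<subseteq> P" for I J
      using that gen_ideal_least[OF that(1)] ideal_carrier[OF that(1)]
      unfolding ideal_op_def by blast
    with L show ?R by blast
  next
    assume R: ?R
    have "x \<in> P" if "l_ideal X I" "\<not> I \<subseteq> P" "x \<in> ideal_op X I P" for I x
      using that R gen_ideal_ideal[of x] gen_ideal_mem[of x] unfolding ideal_op_def by blast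
    then show ?L by blast
  qed
  then show ?thesis unfolding prime_ideal_def by blast
qed

lemma prime_ideal_inter:
  "prime_ideal X P \<Longrightarrow> l_ideal X I \<Longrightarrow> l_ideal X J \<Longrightarrow> I \<inter> J \<subseteq> P \<Longrightarrow> I \<subseteq> P \<or> J \<subseteq> P"
  by (simp add: prime_ideal_iff_inter)

section \<open>The congruence of an ideal and the join of two ideals\<close>

lemma ideal_cong_refl: "l_ideal X I \<Longrightarrow> x \<in> carrier X \<Longrightarrow> ideal_cong X I x x"
  by (simp add: ideal_cong_def op_self ideal_one)

lemma ideal_cong_trans:
  assumes I: "l_ideal X I" and c: "x \<in> carrier X" "y \<in> carrier X" "z \<in> carrier X"
    and xy: "ideal_cong X I x y" and yz: "ideal_cong X I y z"
  shows "ideal_cong X I x z"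
proof -
  have "a \<cdot> c \<in> I" if "a \<cdot> b \<in> I" "b \<cdot> c \<in> I" "a \<in> carrier X" "b \<in> carrier X" "c \<in> carrier X" for a b c
  proof -
    \<comment> \<open>The cycloid law produces a product ending in \<open>b \<cdot> c\<close>, to
      which I2 applies; I1 along \<open>a \<cdot> b\<close> then strips the left factor.\<close>
    have "(a \<cdot> b) \<cdot> (a \<cdot> c) = (b \<cdot> a) \<cdot> (b \<cdot> c)" using that cycloid by simp
    also have "\<dots> \<in> I" using that by (auto intro: ideal_I2[OF I that(2)] op_closed)
    finally show ?thesis by (rule ideal_I1[OF I that(1), rotated]) (simp add: that op_closed)
  qed
  then show ?thesis using assms unfolding ideal_cong_def by blast
qed

lemma ideal_cong_mem:
  assumes "l_ideal X I" "x \<in> carrier X" "y \<in> I" "ideal_cong X I x y"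
  shows "x \<in> I"
  using assms ideal_I1[OF assms(1,3,2)] unfolding ideal_cong_def by simp

lemma ideal_cong_op_right:
  assumes I: "l_ideal X I" and c: "x \<in> carrier X" "y \<in> carrier X" "z \<in> carrier X"
    and xy: "ideal_cong X I x y"
  shows "ideal_cong X I (z \<cdot> x) (z \<cdot> y)"
proof -
  have "(z \<cdot> x) \<cdot> (z \<cdot> y) = (x \<cdot> z) \<cdot> (x \<cdot> y)" "(z \<cdot> y) \<cdot> (z \<cdot> x) = (y \<cdot> z) \<cdot> (y \<cdot> x)"
    using c cycloid by auto
  then show ?thesis
    using xy ideal_I2[OF I _ op_closed[OF c(1,3)]] ideal_I2[OF I _ op_closed[OF c(2,3)]]
    unfolding ideal_cong_def by simp
qed

text \<open>I3 and I4 are precisely the two halves of the claim: modulo \<open>I\<close>, an element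
  of \<open>I\<close> multiplies from the left like \<open>\<one>\<close>.\<close>

lemma ideal_op_cong:
  "l_ideal X I \<Longrightarrow> a \<in> I \<Longrightarrow> x \<in> carrier X \<Longrightarrow> ideal_cong X I (a \<cdot> x) x"
  by (simp add: ideal_cong_def ideal_I3 ideal_I4)

text \<open>Both \<open>x \<cdot> y\<close> and \<open>y \<cdot> x\<close> multiply from the left
  like \<open>\<one>\<close> modulo \<open>I\<close>, so the two sides of the cycloid law reduce to
  \<open>x \<cdot> z\<close> and \<open>y \<cdot> z\<close>.\<close>

lemma ideal_cong_op_left:
  assumes I: "l_ideal X I" and c: "x \<in> carrier X" "y \<in> carrier X" "z \<in> carrier X"
    and xy: "ideal_cong X I x y"
  shows "ideal_cong X I (x \<cdot> z) (y \<cdot> z)"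
proof -
  have "ideal_cong X I ((x \<cdot> y) \<cdot> (x \<cdot> z)) (x \<cdot> z)" "ideal_cong X I ((y \<cdot> x) \<cdot> (y \<cdot> z)) (y \<cdot> z)"
    using xy c by (simp_all add: ideal_cong_def[of _ _ x y] ideal_op_cong[OF I] op_closed)
  moreover have "(x \<cdot> y) \<cdot> (x \<cdot> z) = (y \<cdot> x) \<cdot> (y \<cdot> z)" using c cycloid by simp
  ultimately show ?thesis
    using ideal_cong_trans[OF I, of "x \<cdot> z" "(x \<cdot> y) \<cdot> (x \<cdot> z)" "y \<cdot> z"] c
    by (simp add: op_closed ideal_cong_sym)
qed

lemma ideal_cong_op:
  assumes I: "l_ideal X I"
    and c: "x \<in> carrier X" "y \<in> carrier X" "x' \<in> carrier X" "y' \<in> carrier X"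
    and "ideal_cong X I x x'" "ideal_cong X I y y'"
  shows "ideal_cong X I (x \<cdot> y) (x' \<cdot> y')"
  using ideal_cong_trans[OF I, of "x \<cdot> y" "x' \<cdot> y" "x' \<cdot> y'"] assms
    ideal_cong_op_left[OF I, of x x' y] ideal_cong_op_right[OF I, of y y' x']
  by (simp add: op_closed)

text \<open>The witness for permuting the congruences at \<open>1\<close> is \<open>a \<cdot> x\<close>.\<close>

lemma ideal_join_commute_subset:
  assumes I: "l_ideal X I" and J: "l_ideal X J"
  shows "ideal_join X I J \<subseteq> ideal_join X J I"
proof
  fix x assume "x \<in> ideal_join X I J"
  then obtain a where x: "x \<in> carrier X" and a: "a \<in> J" and xa: "ideal_cong X I x a"
    by (auto simp: ideal_join_def)
  have "a \<cdot> x \<in> I" using xa by (simp add: ideal_cong_def)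
  moreover have "ideal_cong X J x (a \<cdot> x)" by (rule ideal_cong_sym[OF ideal_op_cong[OF J a x]])
  ultimately show "x \<in> ideal_join X J I" using x by (auto simp: ideal_join_def)
qed

lemma ideal_join_commute:
  "l_ideal X I \<Longrightarrow> l_ideal X J \<Longrightarrow> ideal_join X I J = ideal_join X J I"
  using ideal_join_commute_subset by blast

lemma ideal_join_cong:
  assumes I: "l_ideal X I" and J: "l_ideal X J" and x: "x \<in> carrier X"
    and y: "y \<in> ideal_join X I J" and xy: "ideal_cong X I x y"
  shows "x \<in> ideal_join X I J"
proof -
  obtain a where "y \<in> carrier X" "a \<in> J" "ideal_cong X I y a" using y by (auto simp: ideal_join_def)
  then show ?thesis
    using ideal_cong_trans[OF I x _ _ xy] x ideal_carrier[OF J] by (auto simp: ideal_join_def)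
qed

lemma ideal_join_upper2: "l_ideal X I \<Longrightarrow> l_ideal X J \<Longrightarrow> J \<subseteq> ideal_join X I J"
  using ideal_cong_refl ideal_carrier unfolding ideal_join_def by fastforce

lemma ideal_join_upper1: "l_ideal X I \<Longrightarrow> l_ideal X J \<Longrightarrow> I \<subseteq> ideal_join X I J"
  using ideal_join_upper2[of J I] ideal_join_commute by blast

text \<open>I2, I3 and I4 pass from \<open>a \<in> J\<close> to any \<open>x\<close> congruent to
  \<open>a\<close> modulo \<open>I\<close>, because the products involved respect the congruence. I1
  is different: \<open>y\<close> is related to \<open>a \<cdot> y\<close> modulo \<open>J\<close>,
  while the join visibly absorbs only congruence modulo \<open>I\<close>.\<close>

lemma ideal_join_ideal:
  assumes I: "l_ideal X I" and J: "l_ideal X J"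
  shows "l_ideal X (ideal_join X I J)"
  unfolding l_ideal_def
proof (intro conjI ballI)
  let ?V = "ideal_join X I J"
  show "?V \<subseteq> carrier X" by (auto simp: ideal_join_def)
  show "?V \<noteq> {}" using ideal_join_upper1[OF I J] ideal_one[OF I] by blast
  fix x y assume "x \<in> ?V" and y: "y \<in> carrier X"
  then obtain a where x: "x \<in> carrier X" and a: "a \<in> J" and xa: "ideal_cong X I x a"
    by (auto simp: ideal_join_def)
  note aX = ideal_carrier[OF J a]
  have xy: "ideal_cong X I (x \<cdot> y) (a \<cdot> y)" by (rule ideal_cong_op_left[OF I x aX y xa])
  show "x \<cdot> y \<in> ?V \<longrightarrow> y \<in> ?V"
  proof
    assume "x \<cdot> y \<in> ?V"
    with ideal_cong_sym[OF xy] have "a \<cdot> y \<in> ideal_join X I J"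
      by (rule ideal_join_cong[OF I J op_closed[OF aX y], rotated])
    \<comment> \<open>The other description of the join absorbs congruence modulo \<open>J\<close>,
      which relates \<open>a \<cdot> y\<close> to \<open>y\<close>.\<close>
    then have "a \<cdot> y \<in> ideal_join X J I" using ideal_join_commute[OF I J] by simp
    then have "y \<in> ideal_join X J I"
      by (rule ideal_join_cong[OF J I y]) (rule ideal_cong_sym[OF ideal_op_cong[OF J a y]])
    then show "y \<in> ?V" using ideal_join_commute[OF I J] by simp
  qed
  have V: "z \<in> ?V" if "ideal_cong X I z b" "b \<in> J" "z \<in> carrier X" for z b
    using that by (auto simp: ideal_join_def)
  show "y \<cdot> x \<in> ?V"
    by (rule V[OF ideal_cong_op_right[OF I x aX y xa] ideal_I2[OF J a y] op_closed[OF y x]])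
  show "(x \<cdot> y) \<cdot> y \<in> ?V"
    by (rule V[OF ideal_cong_op_left[OF I _ _ _ xy] ideal_I3[OF J a y]]) (simp_all add: op_closed x y aX)
  show "y \<cdot> (x \<cdot> y) \<in> ?V"
    by (rule V[OF ideal_cong_op_right[OF I _ _ _ xy] ideal_I4[OF J a y]]) (simp_all add: op_closed x y aX)
qed

end

subsection \<open>Ideals of the semidirect product\<close>

locale l_alg_operation = X: l_algebra X + Y: l_algebra Y
  for X :: "'a l_alg" (structure) and Y :: "'b l_alg" (structure) +
  fixes \<rho> :: "'b \<Rightarrow> 'a \<Rightarrow> 'a"
  assumes operation: "l_operation X Y \<rho>"
begin

abbreviation S :: "('a \<times> 'b) l_alg" where "S \<equiv> semidirect X Y \<rho>"

text \<open>The elements inducing the identity on \<open>X/P\<close>, as a plain set; the kernel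
  will be the largest ideal contained in it.\<close>

definition acts_trivially :: "'a set \<Rightarrow> 'b set" where
  "acts_trivially P = {u \<in> carrier Y. \<forall>x\<in>carrier X. ideal_cong X P (\<rho> u x) x}"

lemma rho_closed: "u \<in> carrier Y \<Longrightarrow> x \<in> carrier X \<Longrightarrow> \<rho> u x \<in> carrier X"
  using operation by (auto simp: l_operation_def l_End_def Pi_iff)

lemma rho_op: "u \<in> carrier Y \<Longrightarrow> x \<in> carrier X \<Longrightarrow> y \<in> carrier X
    \<Longrightarrow> \<rho> u (x \<cdot>\<^bsub>X\<^esub> y) = \<rho> u x \<cdot>\<^bsub>X\<^esub> \<rho> u y"
  using operation by (auto simp: l_operation_def l_End_def Pi_iff)

lemma rho_one: "x \<in> carrier X \<Longrightarrow> \<rho> \<one>\<^bsub>Y\<^esub> x = x"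
  using operation by (auto simp: l_operation_def)

lemma rho_rho: "u \<in> carrier Y \<Longrightarrow> v \<in> carrier Y \<Longrightarrow> x \<in> carrier X
    \<Longrightarrow> \<rho> (u \<cdot>\<^bsub>Y\<^esub> v) (\<rho> u x) = \<rho> (v \<cdot>\<^bsub>Y\<^esub> u) (\<rho> v x)"
  using operation by (auto simp: l_operation_def)

lemma rho_unit: "u \<in> carrier Y \<Longrightarrow> \<rho> u \<one>\<^bsub>X\<^esub> = \<one>\<^bsub>X\<^esub>"
  using rho_op[of u "\<one>\<^bsub>X\<^esub>" "\<one>\<^bsub>X\<^esub>"] X.one_closed X.op_self rho_closed by metis

section \<open>The L-algebra axioms for the semidirect product\<close>

lemma carrier_S: "carrier S = carrier X \<times> carrier Y"
  by (simp add: semidirect_def)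

lemma one_S: "\<one>\<^bsub>S\<^esub> = (\<one>\<^bsub>X\<^esub>, \<one>\<^bsub>Y\<^esub>)"
  by (simp add: semidirect_def)

lemma op_S: "(x, u) \<cdot>\<^bsub>S\<^esub> (y, v) = (\<rho> (u \<cdot>\<^bsub>Y\<^esub> v) x \<cdot>\<^bsub>X\<^esub> \<rho> (v \<cdot>\<^bsub>Y\<^esub> u) y, u \<cdot>\<^bsub>Y\<^esub> v)"
  by (simp add: semidirect_def)

lemmas alg_simps = X.one_closed Y.one_closed X.op_closed Y.op_closed X.one_op Y.one_op X.op_one
  Y.op_one X.op_self Y.op_self rho_closed rho_one rho_unit

lemma semidirect_l_algebra: "l_algebra S"
proof
  show "\<one>\<^bsub>S\<^esub> \<in> carrier S" by (simp add: carrier_S one_S alg_simps)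
next
  fix p q assume "p \<in> carrier S" "q \<in> carrier S"
  then show "p \<cdot>\<^bsub>S\<^esub> q \<in> carrier S" by (auto simp: carrier_S op_S alg_simps)
next
  fix p assume "p \<in> carrier S"
  then show "\<one>\<^bsub>S\<^esub> \<cdot>\<^bsub>S\<^esub> p = p" "p \<cdot>\<^bsub>S\<^esub> \<one>\<^bsub>S\<^esub> = \<one>\<^bsub>S\<^esub>" "p \<cdot>\<^bsub>S\<^esub> p = \<one>\<^bsub>S\<^esub>"
    by (auto simp: carrier_S one_S op_S alg_simps)
next
  fix p q r assume "p \<in> carrier S" "q \<in> carrier S" "r \<in> carrier S"
  then obtain x u y v z w where eq: "p = (x, u)" "q = (y, v)" "r = (z, w)"
    and x: "x \<in> carrier X" "y \<in> carrier X" "z \<in> carrier X"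
    and u: "u \<in> carrier Y" "v \<in> carrier Y" "w \<in> carrier Y"
    by (auto simp: carrier_S)
  note cl = x u X.op_closed Y.op_closed rho_closed
  let ?m = "(\<cdot>\<^bsub>Y\<^esub>)"
  \<comment> \<open>\<open>a\<close>, \<open>b\<close>, \<open>c\<close> are the first components of
    \<open>p\<close>, \<open>q\<close>, \<open>r\<close> after all actions occurring in the iterated
    products. By \<open>rho_rho\<close> and the cycloid law of \<open>Y\<close>, each is reached
    along different routes with the same result (\<open>a1\<close>, \<open>b1\<close>,
    \<open>c1\<close>), so the law for \<open>S\<close> becomes the one for \<open>a\<close>,
    \<open>b\<close>, \<open>c\<close> in \<open>X\<close>.\<close>
  define a where "a = \<rho> (?m (?m u v) (?m u w)) (\<rho> (?m u v) x)"
  define b where "b = \<rho> (?m (?m u v) (?m u w)) (\<rho> (?m v u) y)"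
  define c where "c = \<rho> (?m (?m u w) (?m u v)) (\<rho> (?m w u) z)"
  have uv: "?m (?m u v) (?m u w) = ?m (?m v u) (?m v w)"
    and uw: "?m (?m u w) (?m u v) = ?m (?m w u) (?m w v)"
    and vw: "?m (?m v w) (?m v u) = ?m (?m w v) (?m w u)"
    using Y.cycloid u by auto
  have a1: "\<rho> (?m (?m u w) (?m u v)) (\<rho> (?m u w) x) = a"
    unfolding a_def by (rule rho_rho) (auto simp: cl)
  have b1: "\<rho> (?m (?m v w) (?m v u)) (\<rho> (?m v w) y) = b"
    unfolding b_def uv by (rule rho_rho) (auto simp: cl)
  have c1: "\<rho> (?m (?m v w) (?m v u)) (\<rho> (?m w v) z) = c"
    unfolding c_def uw vw by (rule rho_rho) (auto simp: cl)
  have c: "a \<in> carrier X" "b \<in> carrier X" "c \<in> carrier X" by (auto simp: a_def b_def c_def cl)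
  have "(p \<cdot>\<^bsub>S\<^esub> q) \<cdot>\<^bsub>S\<^esub> (p \<cdot>\<^bsub>S\<^esub> r) = ((a \<cdot>\<^bsub>X\<^esub> b) \<cdot>\<^bsub>X\<^esub> (a \<cdot>\<^bsub>X\<^esub> c), ?m (?m u v) (?m u w))"
    unfolding eq op_S by (simp add: rho_op cl a1 a_def[symmetric] b_def[symmetric] c_def[symmetric])
  moreover have "(q \<cdot>\<^bsub>S\<^esub> p) \<cdot>\<^bsub>S\<^esub> (q \<cdot>\<^bsub>S\<^esub> r) = ((b \<cdot>\<^bsub>X\<^esub> a) \<cdot>\<^bsub>X\<^esub> (b \<cdot>\<^bsub>X\<^esub> c), ?m (?m u v) (?m u w))"
    unfolding eq op_S
    by (simp add: rho_op cl b1 c1 uv[symmetric] a_def[symmetric] b_def[symmetric])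
  ultimately show "(p \<cdot>\<^bsub>S\<^esub> q) \<cdot>\<^bsub>S\<^esub> (p \<cdot>\<^bsub>S\<^esub> r) = (q \<cdot>\<^bsub>S\<^esub> p) \<cdot>\<^bsub>S\<^esub> (q \<cdot>\<^bsub>S\<^esub> r)"
    using X.cycloid[OF c] by simp
next
  fix p q assume "p \<in> carrier S" "q \<in> carrier S" "p \<cdot>\<^bsub>S\<^esub> q = \<one>\<^bsub>S\<^esub>" "q \<cdot>\<^bsub>S\<^esub> p = \<one>\<^bsub>S\<^esub>"
  then obtain x u y v where eq: "p = (x, u)" "q = (y, v)"
    and c: "x \<in> carrier X" "y \<in> carrier X" "u \<in> carrier Y" "v \<in> carrier Y"
    and uv: "u \<cdot>\<^bsub>Y\<^esub> v = \<one>\<^bsub>Y\<^esub>" "v \<cdot>\<^bsub>Y\<^esub> u = \<one>\<^bsub>Y\<^esub>"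
    and xy: "\<rho> (u \<cdot>\<^bsub>Y\<^esub> v) x \<cdot>\<^bsub>X\<^esub> \<rho> (v \<cdot>\<^bsub>Y\<^esub> u) y = \<one>\<^bsub>X\<^esub>"
      "\<rho> (v \<cdot>\<^bsub>Y\<^esub> u) y \<cdot>\<^bsub>X\<^esub> \<rho> (u \<cdot>\<^bsub>Y\<^esub> v) x = \<one>\<^bsub>X\<^esub>"
    by (auto simp: carrier_S op_S one_S)
  show "p = q" using X.antisym[of x y] Y.antisym[of u v] xy c uv by (simp add: eq rho_one)
qed

sublocale S: l_algebra S
  by (rule semidirect_l_algebra)

section \<open>Ideals of the semidirect product as products\<close>

lemma semidirect_ideal_Times:
  assumes K: "l_ideal S K"
  shows "K = {x. (x, \<one>\<^bsub>Y\<^esub>) \<in> K} \<times> {u. (\<one>\<^bsub>X\<^esub>, u) \<in> K}"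
proof -
  have *: "(x, u) \<in> K \<longleftrightarrow> (x, \<one>\<^bsub>Y\<^esub>) \<in> K \<and> (\<one>\<^bsub>X\<^esub>, u) \<in> K" for x u
  proof
    assume xu: "(x, u) \<in> K"
    then have c: "x \<in> carrier X" "u \<in> carrier Y" using ideal_carrier[OF K xu] by (auto simp: carrier_S)
    \<comment> \<open>This product equals \<open>(x, \<one>)\<close>, which settles one component by
      I2. The reversed product is the unit, so I1 settles the other.\<close>
    have "(\<one>\<^bsub>X\<^esub>, u) \<cdot>\<^bsub>S\<^esub> (x, u) \<in> K"
      by (rule ideal_I2[OF K xu]) (simp add: carrier_S c alg_simps)
    moreover have "(x, u) \<cdot>\<^bsub>S\<^esub> (\<one>\<^bsub>X\<^esub>, u) = \<one>\<^bsub>S\<^esub>" by (simp add: op_S one_S c alg_simps)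
    then have "(\<one>\<^bsub>X\<^esub>, u) \<in> K"
      using ideal_I1[OF K xu, of "(\<one>\<^bsub>X\<^esub>, u)"] S.ideal_one[OF K] by (simp add: carrier_S c alg_simps)
    ultimately show "(x, \<one>\<^bsub>Y\<^esub>) \<in> K \<and> (\<one>\<^bsub>X\<^esub>, u) \<in> K" by (simp add: op_S c alg_simps)
  next
    assume a: "(x, \<one>\<^bsub>Y\<^esub>) \<in> K \<and> (\<one>\<^bsub>X\<^esub>, u) \<in> K"
    then have c: "x \<in> carrier X" "u \<in> carrier Y"
      using ideal_carrier[OF K, of "(x, \<one>\<^bsub>Y\<^esub>)"] ideal_carrier[OF K, of "(\<one>\<^bsub>X\<^esub>, u)"]
      by (simp_all add: carrier_S)
    have "(\<one>\<^bsub>X\<^esub>, u) \<cdot>\<^bsub>S\<^esub> (x, u) = (x, \<one>\<^bsub>Y\<^esub>)" by (simp add: op_S c alg_simps)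
    with a show "(x, u) \<in> K"
      using ideal_I1[OF K, of "(\<one>\<^bsub>X\<^esub>, u)" "(x, u)"] by (simp add: carrier_S c)
  qed
  show ?thesis
  proof (rule Set.set_eqI)
    fix p show "p \<in> K \<longleftrightarrow> p \<in> {x. (x, \<one>\<^bsub>Y\<^esub>) \<in> K} \<times> {u. (\<one>\<^bsub>X\<^esub>, u) \<in> K}"
      using *[of "fst p" "snd p"] by (simp add: mem_Times_iff)
  qed
qed

lemma semidirect_ideal_imp:
  assumes K: "l_ideal S (I \<times> U)"
  shows "rho_ideal X Y \<rho> I" "l_ideal Y U" "U \<subseteq> acts_trivially I"
proof -
  have one: "\<one>\<^bsub>X\<^esub> \<in> I" "\<one>\<^bsub>Y\<^esub> \<in> U" using S.ideal_one[OF K] by (auto simp: one_S)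
  have sub: "I \<subseteq> carrier X" "U \<subseteq> carrier Y"
    using ideal_carrier[OF K] one by (auto simp: carrier_S)
  show "rho_ideal X Y \<rho> I"
    unfolding rho_ideal_def l_ideal_def
  proof (intro conjI ballI)
    show "I \<subseteq> carrier X" "I \<noteq> {}" using sub one by auto
    show "\<rho> v ` I \<subseteq> I" if v: "v \<in> carrier Y" for v
    proof
      fix z assume "z \<in> \<rho> v ` I"
      then obtain x where x: "x \<in> I" "z = \<rho> v x" by auto
      \<comment> \<open>The product is \<open>(\<rho> v x, \<one>)\<close>, so I2 in
        \<open>S\<close> encodes invariance under the action.\<close>
      have "(\<one>\<^bsub>X\<^esub>, v) \<cdot>\<^bsub>S\<^esub> (x, \<one>\<^bsub>Y\<^esub>) \<in> I \<times> U"
        by (rule ideal_I2[OF K]) (use x one v in \<open>auto simp: carrier_S alg_simps\<close>)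
      then show "z \<in> I" using x v sub by (auto simp: op_S alg_simps)
    qed
    fix x y assume xy: "x \<in> I" "y \<in> carrier X"
    then have x: "(x, \<one>\<^bsub>Y\<^esub>) \<in> I \<times> U" "(y, \<one>\<^bsub>Y\<^esub>) \<in> carrier S" and xX: "x \<in> carrier X"
      using one sub by (auto simp: carrier_S alg_simps)
    show "x \<cdot>\<^bsub>X\<^esub> y \<in> I \<longrightarrow> y \<in> I" using ideal_I1[OF K x] xy xX one by (simp add: op_S alg_simps)
    show "y \<cdot>\<^bsub>X\<^esub> x \<in> I" using ideal_I2[OF K x] xy xX by (simp add: op_S alg_simps)
    show "(x \<cdot>\<^bsub>X\<^esub> y) \<cdot>\<^bsub>X\<^esub> y \<in> I" using ideal_I3[OF K x] xy xX by (simp add: op_S alg_simps)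
    show "y \<cdot>\<^bsub>X\<^esub> (x \<cdot>\<^bsub>X\<^esub> y) \<in> I" using ideal_I4[OF K x] xy xX by (simp add: op_S alg_simps)
  qed
  show "l_ideal Y U"
    unfolding l_ideal_def
  proof (intro conjI ballI)
    show "U \<subseteq> carrier Y" "U \<noteq> {}" using sub one by auto
    fix u v assume uv: "u \<in> U" "v \<in> carrier Y"
    then have u: "(\<one>\<^bsub>X\<^esub>, u) \<in> I \<times> U" "(\<one>\<^bsub>X\<^esub>, v) \<in> carrier S" and uY: "u \<in> carrier Y"
      using one sub by (auto simp: carrier_S alg_simps)
    show "u \<cdot>\<^bsub>Y\<^esub> v \<in> U \<longrightarrow> v \<in> U" using ideal_I1[OF K u] uv uY one by (simp add: op_S alg_simps)
    show "v \<cdot>\<^bsub>Y\<^esub> u \<in> U" using ideal_I2[OF K u] uv uY by (simp add: op_S alg_simps)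
    show "(u \<cdot>\<^bsub>Y\<^esub> v) \<cdot>\<^bsub>Y\<^esub> v \<in> U" using ideal_I3[OF K u] uv uY by (simp add: op_S alg_simps)
    show "v \<cdot>\<^bsub>Y\<^esub> (u \<cdot>\<^bsub>Y\<^esub> v) \<in> U" using ideal_I4[OF K u] uv uY by (simp add: op_S alg_simps)
  qed
  show "U \<subseteq> acts_trivially I"
  proof
    fix u assume u: "u \<in> U"
    then have uY: "u \<in> carrier Y" using sub by auto
    have "ideal_cong X I (\<rho> u x) x" if x: "x \<in> carrier X" for x
    proof -
      \<comment> \<open>Since \<open>(\<one>, u) \<cdot> (x, \<one>) = (\<rho> u x, \<one>)\<close>,
        I3 and I4 for this pair give the two halves of the congruence of \<open>\<rho> u x\<close>
        and \<open>x\<close>.\<close>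
      have "(\<one>\<^bsub>X\<^esub>, u) \<in> I \<times> U" "(x, \<one>\<^bsub>Y\<^esub>) \<in> carrier S" using u one x by (auto simp: carrier_S alg_simps)
      from ideal_I3[OF K this] ideal_I4[OF K this] show ?thesis
        using x uY by (simp add: op_S alg_simps ideal_cong_def)
    qed
    then show "u \<in> acts_trivially I" using uY by (simp add: acts_trivially_def)
  qed
qed

text \<open>All is decided by first components modulo \<open>I\<close>: elements of \<open>I\<close>
  multiply from the left like \<open>\<one>\<close>, and elements of \<open>U\<close> act as the
  identity. Hence the first component of \<open>p \<cdot> q\<close> is congruent to that of
  \<open>q\<close>, which gives I1 and prepares I3 and I4.\<close>

lemma semidirect_idealI:
  assumes I: "rho_ideal X Y \<rho> I" and U: "l_ideal Y U" and t: "U \<subseteq> acts_trivially I"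
  shows "l_ideal S (I \<times> U)"
  unfolding l_ideal_def
proof (intro conjI ballI)
  have I': "l_ideal X I" using I by (simp add: rho_ideal_def)
  show "I \<times> U \<subseteq> carrier S" using ideal_carrier[OF I'] ideal_carrier[OF U] by (auto simp: carrier_S)
  show "I \<times> U \<noteq> {}" using X.ideal_one[OF I'] Y.ideal_one[OF U] by auto
  fix p q assume "p \<in> I \<times> U" "q \<in> carrier S"
  then obtain x u y v where eq: "p = (x, u)" "q = (y, v)" and x: "x \<in> I" and u: "u \<in> U"
    and y: "y \<in> carrier X" and v: "v \<in> carrier Y" by (auto simp: carrier_S)
  note c = y v ideal_carrier[OF I' x] ideal_carrier[OF U u] X.op_closed Y.op_closed rho_closed
  have rI: "\<rho> w a \<in> I" if "w \<in> carrier Y" "a \<in> I" for w a using I that by (auto simp: rho_ideal_def)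
  have tr: "ideal_cong X I (\<rho> w a) a" if "w \<in> U" "a \<in> carrier X" for w a
    using t that by (auto simp: acts_trivially_def)
  have vu: "v \<cdot>\<^bsub>Y\<^esub> u \<in> U" using ideal_I2[OF U u v] .
  have wv: "(u \<cdot>\<^bsub>Y\<^esub> v) \<cdot>\<^bsub>Y\<^esub> v \<in> U" using ideal_I3[OF U u v] .
  have vw: "v \<cdot>\<^bsub>Y\<^esub> (u \<cdot>\<^bsub>Y\<^esub> v) \<in> U" using ideal_I4[OF U u v] .
  define z where "z = \<rho> (u \<cdot>\<^bsub>Y\<^esub> v) x \<cdot>\<^bsub>X\<^esub> \<rho> (v \<cdot>\<^bsub>Y\<^esub> u) y"
  have pq: "p \<cdot>\<^bsub>S\<^esub> q = (z, u \<cdot>\<^bsub>Y\<^esub> v)" by (simp add: eq op_S z_def)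
  have zX: "z \<in> carrier X" by (simp add: z_def c)
  have rx: "\<rho> (u \<cdot>\<^bsub>Y\<^esub> v) x \<in> I" by (rule rI) (simp_all add: c x)
  have ry: "ideal_cong X I (\<rho> (v \<cdot>\<^bsub>Y\<^esub> u) y) y" by (rule tr[OF vu y])
  have rz: "ideal_cong X I z (\<rho> (v \<cdot>\<^bsub>Y\<^esub> u) y)"
    unfolding z_def by (rule X.ideal_op_cong[OF I' rx]) (simp add: c)
  have zy: "ideal_cong X I z y"
    by (rule X.ideal_cong_trans[OF I' zX _ y rz ry]) (simp add: c)
  show "p \<cdot>\<^bsub>S\<^esub> q \<in> I \<times> U \<longrightarrow> q \<in> I \<times> U"
    using X.ideal_cong_mem[OF I' y _ ideal_cong_sym[OF zy]] ideal_I1[OF U u v] pq eq by auto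
  show "q \<cdot>\<^bsub>S\<^esub> p \<in> I \<times> U"
    using vu by (simp add: eq op_S c ideal_I2[OF I' rx])
  have mz: "ideal_cong X I (\<rho> ((u \<cdot>\<^bsub>Y\<^esub> v) \<cdot>\<^bsub>Y\<^esub> v) z) y"
    by (rule X.ideal_cong_trans[OF I' _ zX y tr[OF wv zX] zy]) (simp add: c zX)
  have my: "ideal_cong X I (\<rho> (v \<cdot>\<^bsub>Y\<^esub> (u \<cdot>\<^bsub>Y\<^esub> v)) y) y" by (rule tr[OF vw y])
  \<comment> \<open>The first components of the products in I3 and I4 are congruent to
    \<open>y \<cdot> y\<close>, and \<open>I\<close> is closed under its own congruence.\<close>
  have one: "y \<cdot>\<^bsub>X\<^esub> y \<in> I" using X.ideal_one[OF I'] y by (simp add: X.op_self)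
  show "p \<cdot>\<^bsub>S\<^esub> q \<cdot>\<^bsub>S\<^esub> q \<in> I \<times> U"
    using X.ideal_cong_mem[OF I' _ one X.ideal_cong_op[OF I' _ _ y y mz my]] wv
    unfolding pq by (simp add: eq op_S c zX)
  show "q \<cdot>\<^bsub>S\<^esub> (p \<cdot>\<^bsub>S\<^esub> q) \<in> I \<times> U"
    using X.ideal_cong_mem[OF I' _ one X.ideal_cong_op[OF I' _ _ y y my mz]] vw
    unfolding pq by (simp add: eq op_S c zX)
qed

lemma semidirect_ideal_iff:
  "l_ideal S (I \<times> U) \<longleftrightarrow> rho_ideal X Y \<rho> I \<and> l_ideal Y U \<and> U \<subseteq> acts_trivially I"
  using semidirect_ideal_imp semidirect_idealI by blast

lemma semidirect_ideal_cases:
  assumes "l_ideal S K"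
  obtains I U where "K = I \<times> U" "rho_ideal X Y \<rho> I" "l_ideal Y U" "U \<subseteq> acts_trivially I"
  using semidirect_ideal_Times[OF assms] semidirect_ideal_iff assms by metis

lemma rho_ideal_carrier_set: "rho_ideal X Y \<rho> (carrier X)"
  by (simp add: rho_ideal_def X.ideal_carrier_set image_subset_iff rho_closed)

lemma acts_trivially_carrier_set: "acts_trivially (carrier X) = carrier Y"
  by (auto simp: acts_trivially_def ideal_cong_def X.op_closed rho_closed)

lemma acts_trivially_mono: "I \<subseteq> J \<Longrightarrow> acts_trivially I \<subseteq> acts_trivially J"
  by (auto simp: acts_trivially_def intro: ideal_cong_mono)

lemma one_acts_trivially: "l_ideal X I \<Longrightarrow> \<one>\<^bsub>Y\<^esub> \<in> acts_trivially I"
  by (simp add: acts_trivially_def alg_simps X.ideal_cong_refl)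

lemma semidirect_ideal_trivial: "rho_ideal X Y \<rho> I \<Longrightarrow> l_ideal S (I \<times> {\<one>\<^bsub>Y\<^esub>})"
  by (simp add: semidirect_ideal_iff rho_ideal_def Y.ideal_trivial one_acts_trivially)

lemma semidirect_ideal_full: "l_ideal S (carrier X \<times> U) \<longleftrightarrow> l_ideal Y U"
  by (auto simp: semidirect_ideal_iff acts_trivially_carrier_set rho_ideal_carrier_set ideal_carrier)

section \<open>The kernel as the largest trivially acting ideal\<close>

lemma ideal_join_acts_trivially:
  assumes P: "l_ideal X P" and V: "l_ideal Y V" "V \<subseteq> acts_trivially P"
    and W: "l_ideal Y W" "W \<subseteq> acts_trivially P"
  shows "ideal_join Y V W \<subseteq> acts_trivially P"
proof
  fix v assume "v \<in> ideal_join Y V W"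
  then obtain a where v: "v \<in> carrier Y" and a: "a \<in> W" and av: "a \<cdot>\<^bsub>Y\<^esub> v \<in> V"
    by (auto simp: ideal_join_def ideal_cong_def)
  have va: "v \<cdot>\<^bsub>Y\<^esub> a \<in> W" using ideal_I2[OF W(1) a v] .
  note aY = ideal_carrier[OF W(1) a]
  have tr: "ideal_cong X P (\<rho> w x) x" if "w \<in> V \<union> W" "x \<in> carrier X" for w x
    using V W that by (auto simp: acts_trivially_def)
  have "ideal_cong X P (\<rho> v x) x" if x: "x \<in> carrier X" for x
  proof -
    have c: "\<rho> v x \<in> carrier X" "\<rho> (v \<cdot>\<^bsub>Y\<^esub> a) (\<rho> v x) \<in> carrier X" "\<rho> a x \<in> carrier X"
      by (auto simp: v aY x alg_simps)
    \<comment> \<open>The chain runs through \<open>\<rho> v x\<close>, \<open>\<rho> (v \<cdot> a)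
      (\<rho> v x) = \<rho> (a \<cdot> v) (\<rho> a x)\<close>, \<open>\<rho> a x\<close> and
      \<open>x\<close>. Its links hold because \<open>v \<cdot> a \<in> W\<close>,
      \<open>a \<cdot> v \<in> V\<close> and \<open>a \<in> W\<close>.\<close>
    have "ideal_cong X P (\<rho> v x) (\<rho> (v \<cdot>\<^bsub>Y\<^esub> a) (\<rho> v x))" by (rule ideal_cong_sym, rule tr) (use va c in auto)
    moreover have "ideal_cong X P (\<rho> (v \<cdot>\<^bsub>Y\<^esub> a) (\<rho> v x)) (\<rho> a x)"
      unfolding rho_rho[OF v aY x] by (rule tr) (use av c in auto)
    moreover have "ideal_cong X P (\<rho> a x) x" by (rule tr) (use a x in auto)
    ultimately show ?thesis using X.ideal_cong_trans[OF P] c x by meson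
  qed
  then show "v \<in> acts_trivially P" using v by (simp add: acts_trivially_def)
qed

text \<open>The candidate for the kernel. As a union it contains every competing ideal by
  construction, so that only its being an ideal remains to be shown.\<close>

definition trivial_core :: "'a set \<Rightarrow> 'b set" where
  "trivial_core P = \<Union>{V. l_ideal Y V \<and> V \<subseteq> acts_trivially P}"

text \<open>I2, I3 and I4 start from one element and stay in a single member of the union. I1
  involves two members, and is carried out inside their join, which again acts trivially.\<close>

lemma trivial_core_ideal:
  assumes P: "l_ideal X P" shows "l_ideal Y (trivial_core P)"
proof -
  have sub: "V \<subseteq> trivial_core P" if "l_ideal Y V" "V \<subseteq> acts_trivially P" for V
    using that by (auto simp: trivial_core_def)
  have cl: "v \<in> trivial_core P" if uv: "u \<in> trivial_core P" "u \<cdot>\<^bsub>Y\<^esub> v \<in> trivial_core P" "v \<in> carrier Y" for u v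
  proof -
    obtain V W where V: "l_ideal Y V" "V \<subseteq> acts_trivially P" "u \<in> V"
      and W: "l_ideal Y W" "W \<subseteq> acts_trivially P" "u \<cdot>\<^bsub>Y\<^esub> v \<in> W"
      using uv by (auto simp: trivial_core_def)
    have J: "l_ideal Y (ideal_join Y V W)" using Y.ideal_join_ideal V W by blast
    have "u \<in> ideal_join Y V W" "u \<cdot>\<^bsub>Y\<^esub> v \<in> ideal_join Y V W"
      using Y.ideal_join_upper1[OF V(1) W(1)] Y.ideal_join_upper2[OF V(1) W(1)] V W by auto
    with ideal_I1[OF J] uv have "v \<in> ideal_join Y V W" by blast
    with sub[OF J ideal_join_acts_trivially[OF P V(1,2) W(1,2)]] show ?thesis by auto
  qed
  have "l_ideal Y {\<one>\<^bsub>Y\<^esub>}" "{\<one>\<^bsub>Y\<^esub>} \<subseteq> acts_trivially P"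
    using Y.ideal_trivial one_acts_trivially[OF P] by auto
  then have "trivial_core P \<noteq> {}" using sub by blast
  moreover have "trivial_core P \<subseteq> carrier Y" by (auto simp: trivial_core_def acts_trivially_def)
  moreover have "v \<cdot>\<^bsub>Y\<^esub> u \<in> trivial_core P \<and> (u \<cdot>\<^bsub>Y\<^esub> v) \<cdot>\<^bsub>Y\<^esub> v \<in> trivial_core P \<and>
      v \<cdot>\<^bsub>Y\<^esub> (u \<cdot>\<^bsub>Y\<^esub> v) \<in> trivial_core P" if "u \<in> trivial_core P" "v \<in> carrier Y" for u v
    using that ideal_I2[of Y _ u v] ideal_I3[of Y _ u v] ideal_I4[of Y _ u v]
    unfolding trivial_core_def by blast
  ultimately show ?thesis using cl unfolding l_ideal_def by blast
qed

text \<open>For a \<open>\<rho>\<close>-ideal \<open>P\<close>, the ideals competing in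
  \<open>GREATEST\<close> are exactly the members of the union, and the union is itself one of
  them.\<close>

lemma ker_quot_eq:
  assumes P: "rho_ideal X Y \<rho> P"
  shows "ker_quot X Y \<rho> P = trivial_core P"
  unfolding ker_quot_def
proof (rule Greatest_equality)
  show "l_ideal Y (trivial_core P) \<and> l_ideal S (P \<times> trivial_core P)"
    using P trivial_core_ideal by (auto simp: semidirect_ideal_iff rho_ideal_def trivial_core_def)
  show "V \<subseteq> trivial_core P" if "l_ideal Y V \<and> l_ideal S (P \<times> V)" for V
    using that by (auto simp: semidirect_ideal_iff trivial_core_def)
qed

lemma semidirect_ideal_iff_ker:
  "l_ideal S (I \<times> U) \<longleftrightarrow> rho_ideal X Y \<rho> I \<and> l_ideal Y U \<and> U \<subseteq> ker_quot X Y \<rho> I"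
  using ker_quot_eq[of I] by (auto simp: semidirect_ideal_iff trivial_core_def)

lemma ker_quot_ideal: "rho_ideal X Y \<rho> P \<Longrightarrow> l_ideal Y (ker_quot X Y \<rho> P)"
  using trivial_core_ideal by (simp add: ker_quot_eq rho_ideal_def)

text \<open>What acts trivially on \<open>X/I\<close> acts trivially on the coarser quotient
  \<open>X/J\<close>.\<close>

lemma ker_quot_mono:
  assumes "rho_ideal X Y \<rho> I" "rho_ideal X Y \<rho> J" "I \<subseteq> J"
  shows "ker_quot X Y \<rho> I \<subseteq> ker_quot X Y \<rho> J"
  using assms(1,2) acts_trivially_mono[OF assms(3)] by (auto simp: ker_quot_eq trivial_core_def)

subsection \<open>Prime ideals of the semidirect product\<close>

text \<open>From \<open>S\<close> to \<open>Y\<close>, test with the ideals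
  \<open>carrier X \<times> U\<close>. Conversely, \<open>\<one>\<close> lies in every first factor,
  so an inclusion of an intersection in \<open>carrier X \<times> Q\<close> can be read off from the
  second factors alone.\<close>

lemma prime_full_iff: "prime_ideal S (carrier X \<times> Q) \<longleftrightarrow> prime_ideal Y Q"
proof
  assume pr: "prime_ideal S (carrier X \<times> Q)"
  show "prime_ideal Y Q"
    unfolding Y.prime_ideal_iff_inter
  proof (intro conjI allI impI)
    show "l_ideal Y Q" using pr by (simp add: prime_ideal_def semidirect_ideal_full)
    show "Q \<noteq> carrier Y" using pr by (auto simp: prime_ideal_def carrier_S)
    fix U V assume "l_ideal Y U" "l_ideal Y V" "U \<inter> V \<subseteq> Q"
    then have "carrier X \<times> U \<subseteq> carrier X \<times> Q \<or> carrier X \<times> V \<subseteq> carrier X \<times> Q"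
      by (intro S.prime_ideal_inter[OF pr]) (auto simp: semidirect_ideal_full)
    then show "U \<subseteq> Q \<or> V \<subseteq> Q" using X.one_closed by blast
  qed
next
  assume pr: "prime_ideal Y Q"
  show "prime_ideal S (carrier X \<times> Q)"
    unfolding S.prime_ideal_iff_inter
  proof (intro conjI allI impI)
    show "l_ideal S (carrier X \<times> Q)" using pr by (simp add: prime_ideal_def semidirect_ideal_full)
    show "carrier X \<times> Q \<noteq> carrier S"
      using pr X.one_closed by (auto simp: prime_ideal_def carrier_S times_eq_iff)
    fix K L assume K: "l_ideal S K" and L: "l_ideal S L" and sub: "K \<inter> L \<subseteq> carrier X \<times> Q"
    obtain I U where K': "K = I \<times> U" "rho_ideal X Y \<rho> I" "l_ideal Y U" using semidirect_ideal_cases[OF K] .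
    obtain J V where L': "L = J \<times> V" "rho_ideal X Y \<rho> J" "l_ideal Y V" using semidirect_ideal_cases[OF L] .
    have "\<one>\<^bsub>X\<^esub> \<in> I \<inter> J" using K' L' X.ideal_one by (auto simp: rho_ideal_def)
    then have "U \<inter> V \<subseteq> Q" using sub K' L' by blast
    then have "U \<subseteq> Q \<or> V \<subseteq> Q" by (rule Y.prime_ideal_inter[OF pr K'(3) L'(3)])
    moreover have "I \<subseteq> carrier X" "J \<subseteq> carrier X"
      using K'(2) L'(2) by (simp_all add: rho_ideal_def l_ideal_def)
    ultimately show "K \<subseteq> carrier X \<times> Q \<or> L \<subseteq> carrier X \<times> Q"
      unfolding K'(1) L'(1) by blast
  qed
qed

lemma prime_proper_imp:
  assumes pr: "prime_ideal S (P \<times> Q)" and ne: "P \<noteq> carrier X"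
  shows "rho_prime X Y \<rho> P" "Q = ker_quot X Y \<rho> P"
proof -
  have id: "rho_ideal X Y \<rho> P" "l_ideal Y Q" "Q \<subseteq> ker_quot X Y \<rho> P"
    using pr by (auto simp: prime_ideal_def semidirect_ideal_iff_ker)
  then have P: "P \<subseteq> carrier X" "\<one>\<^bsub>X\<^esub> \<in> P" and Q: "\<one>\<^bsub>Y\<^esub> \<in> Q"
    by (auto simp: rho_ideal_def X.ideal_one Y.ideal_one ideal_carrier)
  show "rho_prime X Y \<rho> P"
    unfolding rho_prime_def
  proof (intro conjI allI impI)
    fix I J assume IJ: "rho_ideal X Y \<rho> I \<and> rho_ideal X Y \<rho> J \<and> I \<inter> J \<subseteq> P"
    \<comment> \<open>The second factor \<open>{\<one>}\<close> acts trivially modulo any ideal, so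
      every \<open>\<rho>\<close>-ideal of \<open>X\<close> yields a test ideal of
      \<open>S\<close>.\<close>
    then have "I \<times> {\<one>\<^bsub>Y\<^esub>} \<subseteq> P \<times> Q \<or> J \<times> {\<one>\<^bsub>Y\<^esub>} \<subseteq> P \<times> Q"
      using Q by (intro S.prime_ideal_inter[OF pr]) (auto intro: semidirect_ideal_trivial)
    then show "I \<subseteq> P \<or> J \<subseteq> P" by blast
  qed (use id ne in auto)
  \<comment> \<open>The two test ideals meet in \<open>P \<times> {\<one>}\<close>. The first
    alternative would force \<open>P = carrier X\<close>; the second gives the missing inclusion of
    the kernel in \<open>Q\<close>.\<close>
  have "carrier X \<times> {\<one>\<^bsub>Y\<^esub>} \<subseteq> P \<times> Q \<or> P \<times> ker_quot X Y \<rho> P \<subseteq> P \<times> Q"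
    using Q id ker_quot_ideal[OF id(1)]
    by (intro S.prime_ideal_inter[OF pr])
      (auto simp: semidirect_ideal_iff_ker[of P] intro: semidirect_ideal_trivial rho_ideal_carrier_set)
  then show "Q = ker_quot X Y \<rho> P" using P ne id(3) by blast
qed

text \<open>Since \<open>\<one>\<close> lies in both second factors, the first factors satisfy
  \<open>I \<inter> J \<subseteq> P\<close>, and \<open>\<rho>\<close>-primality applies. The second
  factor then follows by itself: \<open>I \<subseteq> P\<close> gives \<open>U \<subseteq> ker_quot
  X Y \<rho> I \<subseteq> ker_quot X Y \<rho> P\<close>.\<close>

lemma rho_prime_imp_prime:
  assumes pr: "rho_prime X Y \<rho> P"
  shows "prime_ideal S (P \<times> ker_quot X Y \<rho> P)"
  unfolding S.prime_ideal_iff_inter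
proof (intro conjI allI impI)
  have P: "rho_ideal X Y \<rho> P" "P \<noteq> carrier X" using pr by (auto simp: rho_prime_def)
  note kP = ker_quot_ideal[OF P(1)]
  show "l_ideal S (P \<times> ker_quot X Y \<rho> P)" using P kP by (simp add: semidirect_ideal_iff_ker)
  show "P \<times> ker_quot X Y \<rho> P \<noteq> carrier S"
    using P(2) X.one_closed Y.one_closed by (auto simp: carrier_S times_eq_iff)
  fix K L assume K: "l_ideal S K" and L: "l_ideal S L" and sub: "K \<inter> L \<subseteq> P \<times> ker_quot X Y \<rho> P"
  obtain I U where K': "K = I \<times> U" using semidirect_ideal_cases[OF K] .
  obtain J V where L': "L = J \<times> V" using semidirect_ideal_cases[OF L] .
  have KI: "rho_ideal X Y \<rho> I" "l_ideal Y U" "U \<subseteq> ker_quot X Y \<rho> I"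
    and LJ: "rho_ideal X Y \<rho> J" "l_ideal Y V" "V \<subseteq> ker_quot X Y \<rho> J"
    using K L by (auto simp: K' L' semidirect_ideal_iff_ker)
  have "\<one>\<^bsub>Y\<^esub> \<in> U \<inter> V" using KI LJ Y.ideal_one by auto
  then have "I \<inter> J \<subseteq> P" using sub K' L' by blast
  then have "I \<subseteq> P \<or> J \<subseteq> P" using pr KI LJ by (auto simp: rho_prime_def)
  then show "K \<subseteq> P \<times> ker_quot X Y \<rho> P \<or> L \<subseteq> P \<times> ker_quot X Y \<rho> P"
    using ker_quot_mono[OF KI(1) P(1)] ker_quot_mono[OF LJ(1) P(1)] KI(3) LJ(3) K' L' by blast
qed

lemma prime_semidirect_iff:
  "prime_ideal S (P \<times> Q) \<longleftrightarrow>
     (P = carrier X \<and> prime_ideal Y Q) \<or> (rho_prime X Y \<rho> P \<and> Q = ker_quot X Y \<rho> P)"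
proof (cases "P = carrier X")
  case True
  then show ?thesis by (simp add: prime_full_iff rho_prime_def)
next
  case False
  then show ?thesis using prime_proper_imp[of P Q] rho_prime_imp_prime[of P] by auto
qed

section \<open>The bijection between the spectra\<close>

definition spec_map :: "('a \<times> 'b) set \<Rightarrow> 'a set + 'b set" where
  "spec_map K = (if fst ` K = carrier X then Inr (snd ` K) else Inl (fst ` K))"

text \<open>The projections of a product return its factors only if the product is nonempty, which
  holds for ideals.\<close>

lemma spec_map_Times:
  assumes "P \<times> Q \<in> Spec S"
  shows "spec_map (P \<times> Q) = (if P = carrier X then Inr Q else Inl P)"
proof -
  have "P \<times> Q \<noteq> {}" using assms by (auto simp: Spec_def prime_ideal_def l_ideal_def)
  then show ?thesis by (simp add: spec_map_def fst_image_times snd_image_times)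
qed

lemma spec_map_bij: "bij_betw spec_map (Spec S) (rho_Spec X Y \<rho> <+> Spec Y)"
\<comment> \<open>The inverse restores the factor that \<open>spec_map\<close> forgets: on
  \<open>Inl P\<close> it is the kernel, which primality forces, and on \<open>Inr Q\<close> it is
  all of \<open>X\<close>.\<close>
proof (rule bij_betw_byWitness[where f' = "case_sum (\<lambda>P. P \<times> ker_quot X Y \<rho> P) (\<lambda>Q. carrier X \<times> Q)"])
  let ?g = "case_sum (\<lambda>P. P \<times> ker_quot X Y \<rho> P) (\<lambda>Q. carrier X \<times> Q)"
  have main: "spec_map K \<in> rho_Spec X Y \<rho> <+> Spec Y \<and> ?g (spec_map K) = K" if K: "K \<in> Spec S" for K
  proof -
    have "l_ideal S K" using K by (simp add: Spec_def prime_ideal_def)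
    then obtain P Q where eq: "K = P \<times> Q" by (rule semidirect_ideal_cases)
    show ?thesis
      using K prime_full_iff prime_proper_imp[of P Q] spec_map_Times[of P Q]
      by (auto simp: eq Spec_def rho_Spec_def)
  qed
  then show "\<forall>K\<in>Spec S. ?g (spec_map K) = K" "spec_map ` Spec S \<subseteq> rho_Spec X Y \<rho> <+> Spec Y" by auto
  have mem: "?g z \<in> Spec S" if "z \<in> rho_Spec X Y \<rho> <+> Spec Y" for z
    using that rho_prime_imp_prime prime_full_iff by (auto simp: Spec_def rho_Spec_def)
  then show "?g ` (rho_Spec X Y \<rho> <+> Spec Y) \<subseteq> Spec S" by auto
  show "\<forall>z\<in>rho_Spec X Y \<rho> <+> Spec Y. spec_map (?g z) = z"
  proof
    fix z assume z: "z \<in> rho_Spec X Y \<rho> <+> Spec Y"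
    show "spec_map (?g z) = z"
      using z
    proof
      fix P assume P: "z = Inl P" "P \<in> rho_Spec X Y \<rho>"
      then have "P \<noteq> carrier X" by (simp add: rho_Spec_def rho_prime_def)
      then show ?thesis using spec_map_Times[of P "ker_quot X Y \<rho> P"] mem[OF z] P by simp
    next
      fix Q assume "z = Inr Q"
      then show ?thesis using spec_map_Times[of "carrier X" Q] mem[OF z] by simp
    qed
  qed
qed

end

theorem theorem3p17:
  fixes X :: "'a l_alg" and Y :: "'b l_alg" and \<rho> :: "'b \<Rightarrow> 'a \<Rightarrow> 'a"
  assumes "l_algebra X" and "l_algebra Y" and "l_operation X Y \<rho>"
  shows "(\<forall>P Q. l_ideal X P \<longrightarrow> l_ideal Y Q \<longrightarrow>
            (prime_ideal (semidirect X Y \<rho>) (P \<times> Q) \<longleftrightarrow>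
               (P = carrier X \<and> prime_ideal Y Q) \<or>
               (rho_prime X Y \<rho> P \<and> Q = ker_quot X Y \<rho> P)))
       \<and> (\<exists>f. bij_betw f (Spec (semidirect X Y \<rho>)) (rho_Spec X Y \<rho> <+> Spec Y)
            \<and> (\<forall>Q. l_ideal Y Q \<and> carrier X \<times> Q \<in> Spec (semidirect X Y \<rho>)
                 \<longrightarrow> f (carrier X \<times> Q) = Inr Q)
            \<and> (\<forall>P Q. l_ideal X P \<and> l_ideal Y Q \<and> P \<noteq> carrier X
                   \<and> P \<times> Q \<in> Spec (semidirect X Y \<rho>)
                 \<longrightarrow> f (P \<times> Q) = Inl P))"
proof -
  interpret l_alg_operation X Y \<rho>
    using assms by (simp add: l_alg_operation_def l_alg_operation_axioms_def)
  have "\<forall>Q. l_ideal Y Q \<and> carrier X \<times> Q \<in> Spec S \<longrightarrow> spec_map (carrier X \<times> Q) = Inr Q"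
    "\<forall>P Q. l_ideal X P \<and> l_ideal Y Q \<and> P \<noteq> carrier X \<and> P \<times> Q \<in> Spec S
      \<longrightarrow> spec_map (P \<times> Q) = Inl P"
    using spec_map_Times by auto
  with spec_map_bij have "\<exists>f. bij_betw f (Spec S) (rho_Spec X Y \<rho> <+> Spec Y)
      \<and> (\<forall>Q. l_ideal Y Q \<and> carrier X \<times> Q \<in> Spec S \<longrightarrow> f (carrier X \<times> Q) = Inr Q)
      \<and> (\<forall>P Q. l_ideal X P \<and> l_ideal Y Q \<and> P \<noteq> carrier X \<and> P \<times> Q \<in> Spec S
        \<longrightarrow> f (P \<times> Q) = Inl P)"
    by (intro exI[of _ spec_map] conjI)
  then show ?thesis by (intro conjI allI impI prime_semidirect_iff)
qed

end
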